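(* For all $\tau\in\mathbb{H}$, $$h\!\left(\frac{2\tau-1}{7\tau-3}\right)=\frac{h(\tau)-1}{h(\tau)}.$$
   Context: Let $\tau\in\mathbb{H}$, $q=e^{2\pi i\tau}$. Define $h(\tau)=q^{-1}\prod_{k\ge0}\frac{(1-q^{7k+3})(1-q^{7k+4})(1-q^{7k+2})^2(1-q^{7k+5})^2}{(1-q^{7k+1})^3(1-q^{7k+6})^3}$; equivalently $h=uv^2/w^3$ with $u=q^{1/56}\prod_{k\ge0}(1-q^{7k+3})(1-q^{7k+4})(1-q^{7k+7})$, $v=q^{9/56}\prod_{k\ge0}(1-q^{7k+2})(1-q^{7k+5})(1-q^{7k+7})$, $w=q^{25/56}\prod_{k\ge0}(1-q^{7k+1})(1-q^{7k+6})(1-q^{7k+7})$, where $q^\alpha=e^{2\pi i\alpha\tau}$. *)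

theory Defs
  imports "HOL-Analysis.Analysis"
begin

definition nome :: "complex \<Rightarrow> complex" where
  "nome \<tau> = exp (2 * of_real pi * \<i> * \<tau>)"

definition h_fun :: "complex \<Rightarrow> complex" where
  "h_fun \<tau> = (let q = nome \<tau> in
     inverse q * (\<Prod>k. ((1 - q ^ (7*k+3)) * (1 - q ^ (7*k+4)) * (1 - q ^ (7*k+2))^2 * (1 - q ^ (7*k+5))^2)
                        / ((1 - q ^ (7*k+1))^3 * (1 - q ^ (7*k+6))^3)))"

end

theory Submission
  imports Defs "HOL-Complex_Analysis.Complex_Analysis"
begin

text \<open>
  Write \<open>\<theta>\<^sub>T\<close> for the Jacobi theta function of the lattice \<open>\<int> + \<int>T\<close> that vanishes on the lattice.
  With \<open>T = 7\<tau>\<close> and \<open>\<theta>\<^sub>j = \<theta>\<^sub>T(j\<tau>)\<close> one has \<open>h = q \<theta>\<^sub>3 \<theta>\<^sub>2\<^sup>2 / \<theta>\<^sub>1\<^sup>3\<close>. The substitution acts on \<open>T\<close>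
  as \<open>T \<mapsto> T' = (2T - 7)/(T - 3)\<close>, and \<open>\<theta>\<close> at \<open>(T', z/(T - 3))\<close> is a constant times
  \<open>exp (\<pi>iz\<^sup>2/(T - 3)) \<theta>\<^sub>T(z)\<close>, since both sides have the same multipliers and the same simple
  zeros, so that their quotient is constant by Liouville's theorem. The unknown constant cancels in
  \<open>h\<close>, and the index \<open>j\<close> becomes \<open>2j\<close> modulo 7. What remains is the Klein quartic relation between
  \<open>\<theta>\<^sub>1\<close>, \<open>\<theta>\<^sub>2\<close>, \<open>\<theta>\<^sub>3\<close>, an instance of the three-term theta identity, which follows from the same
  Liouville argument.
\<close>

section \<open>Entire functions with equal multipliers\<close>

text \<open>Near a zero \<open>z0\<close> of \<open>g\<close>, cancelling \<open>z - z0\<close> from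
  both functions leaves holomorphic \<open>F\<close> and \<open>G\<close> with
  \<open>G z0 = deriv g z0\<close>, which is nonzero; \<open>F / G\<close> then agrees with the
  extended quotient wherever \<open>G\<close> does not vanish.\<close>

lemma holomorphic_quotient_simple_zeros:
  fixes f g :: "complex \<Rightarrow> complex"
  assumes f: "f holomorphic_on UNIV" and g: "g holomorphic_on UNIV"
    and zeros: "\<And>z. g z = 0 \<Longrightarrow> f z = 0 \<and> deriv g z \<noteq> 0"
  shows "(\<lambda>z. if g z = 0 then deriv f z / deriv g z else f z / g z) holomorphic_on UNIV"
    (is "?k holomorphic_on UNIV")
proof -
  have "?k field_differentiable at z0" for z0
  proof (cases "g z0 = 0")
    case False
    have "open (g -` (-{0}))"
      using g by (intro open_vimage) (auto simp: holomorphic_on_imp_continuous_on)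
    moreover have "(\<lambda>z. f z / g z) holomorphic_on (g -` (-{0}))"
      using f g by (auto intro!: holomorphic_intros elim: holomorphic_on_subset)
    then have "?k holomorphic_on (g -` (-{0}))"
      by (rule holomorphic_transform) auto
    ultimately show ?thesis
      using False by (intro holomorphic_on_imp_differentiable_at[of _ "g -` (-{0})"]) auto
  next
    case True
    define F where "F = (\<lambda>z. if z = z0 then deriv f z0 else (f z - f z0) / (z - z0))"
    define G where "G = (\<lambda>z. if z = z0 then deriv g z0 else (g z - g z0) / (z - z0))"
    have F: "F holomorphic_on UNIV" and G: "G holomorphic_on UNIV"
      unfolding F_def G_def using f g by (auto intro: pole_lemma_open)
    have "open (G -` (-{0}))"
      using G by (intro open_vimage) (auto simp: holomorphic_on_imp_continuous_on)
    moreover have "(\<lambda>z. F z / G z) holomorphic_on (G -` (-{0}))"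
      using F G by (auto intro!: holomorphic_intros elim: holomorphic_on_subset)
    then have "?k holomorphic_on (G -` (-{0}))"
      by (rule holomorphic_transform) (use True zeros in \<open>auto simp: F_def G_def\<close>)
    moreover have "G z0 \<noteq> 0"
      using True zeros by (simp add: G_def)
    ultimately show ?thesis
      by (intro holomorphic_on_imp_differentiable_at[of _ "G -` (-{0})"]) auto
  qed
  then show ?thesis
    by (simp add: holomorphic_on_def field_differentiable_at_within)
qed

lemma shift_int_invariant:
  fixes k :: "complex \<Rightarrow> 'a"
  assumes "\<And>z. k (z + w) = k z"
  shows "k (z + of_int n * w) = k z"
proof (induction n rule: int_induct[of _ 0])
  case (step1 i)
  then show ?case
    using assms[of "z + of_int i * w"] by (simp add: algebra_simps)
next
  case (step2 i)
  then show ?case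
    using assms[of "z + of_int (i - 1) * w"] by (simp add: algebra_simps)
qed simp

lemma doubly_periodic_entire_constant:
  fixes k :: "complex \<Rightarrow> complex"
  assumes k: "k holomorphic_on UNIV" and w: "Im w > 0"
    and p1: "\<And>z. k (z + 1) = k z" and pw: "\<And>z. k (z + w) = k z"
  shows "\<exists>C. \<forall>z. k z = C"
proof -
  \<comment> \<open>A rectangle suffices as compact set: a multiple of \<open>w\<close> first fixes
    the imaginary part, and an integer shift then fixes the real part without disturbing it.\<close>
  let ?K = "cbox 0 (Complex 1 (Im w))"
  have "k z \<in> k ` ?K" for z
  proof -
    define n where "n = \<lfloor>Im z / Im w\<rfloor>"
    define z1 where "z1 = z - of_int n * w"
    define m where "m = \<lfloor>Re z1\<rfloor>"
    define z2 where "z2 = z1 - of_int m"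
    have "of_int n \<le> Im z / Im w" "Im z / Im w \<le> of_int n + 1"
      unfolding n_def by linarith+
    then have "of_int n * Im w \<le> Im z" "Im z \<le> (of_int n + 1) * Im w"
      using w by (auto simp: field_simps)
    then have 1: "0 \<le> Im z2" "Im z2 \<le> Im w"
      by (auto simp: z2_def z1_def algebra_simps)
    have 2: "0 \<le> Re z2" "Re z2 \<le> 1"
      unfolding z2_def m_def by (simp_all, linarith)
    have "z2 \<in> ?K"
      using 1 2 by (auto simp: in_cbox_complex_iff)
    moreover have "k z = k z2"
      using shift_int_invariant[of k w z2 n, OF pw] shift_int_invariant[of k 1 "z2 + of_int n * w" m, OF p1]
      by (simp add: z1_def z2_def algebra_simps)
    ultimately show ?thesis by blast
  qed
  moreover have "compact (k ` ?K)"
    using k by (intro compact_continuous_image compact_cbox)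
       (auto intro: holomorphic_on_imp_continuous_on holomorphic_on_subset)
  ultimately have "bounded (range k)"
    by (meson bounded_subset compact_imp_bounded image_subsetI)
  with k have "k constant_on UNIV"
    by (rule Liouville_theorem)
  then show ?thesis
    by (auto simp: constant_on_def)
qed

text \<open>The common multipliers cancel in \<open>f / g\<close>, and the simple zeros of
  \<open>g\<close> are removable, so the quotient is a doubly periodic entire function. The
  multipliers are left general so that the lemma serves both the three-term identity and the modular
  transformation.\<close>

lemma equal_multipliers_imp_proportional:
  fixes f g c d :: "complex \<Rightarrow> complex" and w :: complex
  assumes f: "f holomorphic_on UNIV" and g: "g holomorphic_on UNIV" and w: "Im w > 0"
    and c: "c holomorphic_on UNIV" "\<And>z. c z \<noteq> 0"
    and d: "d holomorphic_on UNIV" "\<And>z. d z \<noteq> 0"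
    and f1: "\<And>z. f (z + 1) = c z * f z" and g1: "\<And>z. g (z + 1) = c z * g z"
    and fw: "\<And>z. f (z + w) = d z * f z" and gw: "\<And>z. g (z + w) = d z * g z"
    and zeros: "\<And>z. g z = 0 \<Longrightarrow> f z = 0 \<and> deriv g z \<noteq> 0"
  shows "\<exists>C. \<forall>z. f z = C * g z"
proof -
  define k where "k = (\<lambda>z. if g z = 0 then deriv f z / deriv g z else f z / g z)"
  have k: "k holomorphic_on UNIV"
    unfolding k_def using f g zeros by (rule holomorphic_quotient_simple_zeros)
  have inv: "k (z + p) = k z"
    if e: "e holomorphic_on UNIV" "\<And>z. e z \<noteq> 0"
      and fp: "\<And>z. f (z + p) = e z * f z" and gp: "\<And>z. g (z + p) = e z * g z" for e p z
  proof (cases "g z = 0")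
    case False
    then show ?thesis using fp gp e by (simp add: k_def)
  next
    case True
    then have fz: "f z = 0" using zeros by blast
    \<comment> \<open>At a zero of \<open>F\<close> the product rule loses the term with
      \<open>deriv e\<close>. Hence the derivatives obey the same multiplier and their quotient, the
      value of \<open>k\<close> at a zero of \<open>g\<close>, is invariant too.\<close>
    have shift: "deriv F (z + p) = e z * deriv F z"
      if F: "F holomorphic_on UNIV" and Fp: "\<And>z. F (z + p) = e z * F z" and Fz: "F z = 0" for F
    proof -
      have "(F has_field_derivative deriv F (z + p)) (at (z + p))"
        using F by (auto intro: holomorphic_derivI)
      then have "((\<lambda>z. F (z + p)) has_field_derivative deriv F (z + p)) (at z)"
        by (simp add: DERIV_shift)
      moreover have "((\<lambda>z. e z * F z) has_field_derivative e z * deriv F z) (at z)"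
        using F e Fz by (auto intro!: derivative_eq_intros holomorphic_derivI)
      ultimately show ?thesis
        using Fp by (auto intro: DERIV_unique)
    qed
    show ?thesis
      using shift[OF f fp fz] shift[OF g gp True] True gp e by (simp add: k_def)
  qed
  obtain C where C: "\<And>z. k z = C"
    using doubly_periodic_entire_constant[OF k w inv[OF c f1 g1] inv[OF d fw gw]] by blast
  have "f z = C * g z" for z
    using C[of z] zeros[of z] by (auto simp: k_def split: if_splits)
  then show ?thesis by blast
qed

section \<open>The infinite Pochhammer symbol and a theta function\<close>

definition qpoch :: "complex \<Rightarrow> complex \<Rightarrow> complex" where
  "qpoch q x = (\<Prod>n. 1 - q ^ n * x)"

lemma convergent_qpoch:
  fixes q x :: complex
  assumes "norm q < 1"
  shows "convergent_prod (\<lambda>n. 1 - q ^ n * x)"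
proof (rule abs_convergent_prod_imp_convergent_prod, rule summable_imp_abs_convergent_prod)
  have "summable (\<lambda>n. norm q ^ n * norm x)"
    using assms by (intro summable_mult2 summable_geometric) auto
  then show "summable (\<lambda>n. norm (1 - q ^ n * x - 1))"
    by (simp add: norm_mult norm_power)
qed

lemma qpoch_has_prod:
  assumes "norm q < 1"
  shows "(\<lambda>n. 1 - q ^ n * x) has_prod qpoch q x"
  unfolding qpoch_def using convergent_qpoch[OF assms] by (rule convergent_prod_has_prod)

lemma qpoch_shift:
  assumes "norm q < 1"
  shows "qpoch q x = (1 - x) * qpoch q (q * x)"
proof -
  have "(\<lambda>n. 1 - q ^ n * x) has_prod ((\<Prod>k<1. 1 - q ^ k * x) * (\<Prod>k. 1 - q ^ (k + 1) * x))"
    by (rule has_prod_ignore_initial_segment') (rule convergent_qpoch[OF assms])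
  then show ?thesis
    using has_prod_unique2[OF qpoch_has_prod[OF assms]] by (simp add: qpoch_def mult_ac)
qed

lemma qpoch_eq_0_iff:
  assumes "norm q < 1"
  shows "qpoch q x = 0 \<longleftrightarrow> (\<exists>n. q ^ n * x = 1)"
  using has_prod_eq_0_iff[OF qpoch_has_prod[OF assms, of x]] by (auto simp: image_iff)

lemma holomorphic_qpoch:
  assumes q: "norm q < 1"
  shows "qpoch q holomorphic_on UNIV"
proof (rule holomorphic_uniform_sequence)
  fix z :: complex
  let ?P = "\<lambda>N x. \<Prod>n<N. 1 - q ^ n * x"
  have "uniformly_convergent_on (cball z 1) ?P"
  proof (rule uniformly_convergent_on_prod')
    show "uniformly_convergent_on (cball z 1) (\<lambda>N x. \<Sum>n<N. norm (1 - q ^ n * x - 1))"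
    proof (rule Weierstrass_m_test'_ev)
      show "\<forall>\<^sub>F n in sequentially. \<forall>x\<in>cball z 1.
          norm (norm (1 - q ^ n * x - 1)) \<le> norm q ^ n * (norm z + 1)"
      proof (intro always_eventually allI ballI)
        fix n x assume "x \<in> cball z 1"
        then have "norm x \<le> norm z + 1"
          using norm_triangle_sub[of x z] by (simp add: dist_norm norm_minus_commute)
        then show "norm (norm (1 - q ^ n * x - 1)) \<le> norm q ^ n * (norm z + 1)"
          by (simp add: norm_mult norm_power mult_left_mono)
      qed
      show "summable (\<lambda>n. norm q ^ n * (norm z + 1))"
        using q by (intro summable_mult2 summable_geometric) auto
    qed
  qed (auto intro!: continuous_intros)
  then obtain l where l: "uniform_limit (cball z 1) ?P l sequentially"
    by (auto simp: uniformly_convergent_on_def)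
  have "l x = qpoch q x" if "x \<in> cball z 1" for x
  proof -
    \<comment> \<open>\<open>?P n\<close> omits the factor with index \<open>n\<close>, while the
      limit theorem for infinite products includes it; hence the shift by one.\<close>
    have "(\<lambda>n. ?P (Suc n) x) \<longlonglongrightarrow> l x"
      using tendsto_uniform_limitI[OF l that] by (rule filterlim_compose) (rule filterlim_Suc)
    moreover have "(\<lambda>n. ?P (Suc n) x) \<longlonglongrightarrow> qpoch q x"
      using convergent_prod_LIMSEQ[OF convergent_qpoch[OF q, of x]]
      by (simp add: lessThan_Suc_atMost qpoch_def)
    ultimately show ?thesis by (rule LIMSEQ_unique)
  qed
  with l have "uniform_limit (cball z 1) ?P (qpoch q) sequentially"
    by (subst uniform_limit_cong'[of _ _ _ "qpoch q" l]) auto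
  then show "\<exists>d>0. cball z d \<subseteq> UNIV \<and> uniform_limit (cball z d) ?P (qpoch q) sequentially"
    by (intro exI[of _ 1]) auto
qed (auto intro!: holomorphic_intros)

section \<open>The exponential with period 1\<close>

lemma nome_add: "nome (a + b) = nome a * nome b"
  by (simp add: nome_def algebra_simps exp_add)

lemma nome_nonzero [simp]: "nome a \<noteq> 0"
  by (simp add: nome_def)

lemma nome_of_int [simp]: "nome (of_int n) = 1"
  using exp_2pi_1_int[of n] by (simp add: nome_def mult_ac)

lemma nome_0 [simp]: "nome 0 = 1" and nome_1 [simp]: "nome 1 = 1"
  using nome_of_int[of 0] nome_of_int[of 1] by simp_all

lemma nome_half: "nome (1 / 2) = -1"
  by (simp add: nome_def exp_pi_i)

lemma nome_power: "nome a ^ n = nome (of_nat n * a)"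
  by (simp add: nome_def exp_of_nat_mult[symmetric] algebra_simps)

lemma nome_minus: "nome (- a) = inverse (nome a)"
  by (simp add: nome_def exp_minus)

lemma nome_eq_1_iff: "nome a = 1 \<longleftrightarrow> (\<exists>n. a = of_int n)"
proof
  assume "nome a = 1"
  then obtain n where "Re (2 * of_real pi * \<i> * a) = 0" "Im (2 * of_real pi * \<i> * a) = of_int (2 * n) * pi"
    unfolding nome_def exp_eq_1 by blast
  then show "\<exists>n. a = of_int n"
    by (auto simp: complex_eq_iff)
qed auto

lemma norm_nome_less_1: "Im T > 0 \<Longrightarrow> norm (nome T) < 1"
  by (simp add: nome_def)

lemma holomorphic_nome [holomorphic_intros]:
  "f holomorphic_on A \<Longrightarrow> (\<lambda>z. nome (f z)) holomorphic_on A"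
  unfolding nome_def by (intro holomorphic_intros)

lemma has_field_derivative_nome:
  assumes "(f has_field_derivative f') (at z)"
  shows "((\<lambda>z. nome (f z)) has_field_derivative 2 * of_real pi * \<i> * f' * nome (f z)) (at z)"
  unfolding nome_def using assms by (auto intro!: derivative_eq_intros)

text \<open>Up to a constant factor this is the classical \<open>\<theta>\<^sub>1\<close>.\<close>
definition theta :: "complex \<Rightarrow> complex \<Rightarrow> complex" where
  "theta T w = nome (- w / 2) * qpoch (nome T) (nome w) * qpoch (nome T) (nome (T - w))"

section \<open>Symmetries, multipliers and zeros of \<open>theta\<close>\<close>

context
  fixes T :: complex
  assumes T: "Im T > 0"
begin

lemma qpoch_nome_shift: "qpoch (nome T) (nome w) = (1 - nome w) * qpoch (nome T) (nome (w + T))"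
  using qpoch_shift[OF norm_nome_less_1[OF T], of "nome w"] by (simp add: nome_add mult.commute)

lemma holomorphic_qpoch_nome:
  assumes "f holomorphic_on UNIV"
  shows "(\<lambda>w. qpoch (nome T) (nome (f w))) holomorphic_on UNIV"
  using holomorphic_on_compose_gen[OF holomorphic_nome[OF assms] holomorphic_qpoch[OF norm_nome_less_1[OF T]]]
  by (simp add: o_def)

lemma holomorphic_theta: "theta T holomorphic_on UNIV"
  unfolding theta_def[abs_def] by (intro holomorphic_intros holomorphic_qpoch_nome) auto

text \<open>Once the first factor is split off, the two remaining products are exchanged by the
  reflection, and that factor times the half-exponential is odd.\<close>

lemma theta_minus: "theta T (- w) = - theta T w"
proof -
  have 1: "nome (w / 2) * (1 - nome (- w)) = - nome (- w / 2) * (1 - nome w)"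
    using nome_add[of "w / 2" "- w"] nome_add[of "- w / 2" w] by (simp add: algebra_simps)
  have "theta T (- w) = (nome (w / 2) * (1 - nome (- w))) * qpoch (nome T) (nome (T - w)) * qpoch (nome T) (nome (T + w))"
    unfolding theta_def by (simp add: qpoch_nome_shift[of "- w"])
  also have "\<dots> = - theta T w"
    unfolding 1 theta_def by (simp add: qpoch_nome_shift[of w] add.commute)
  finally show ?thesis .
qed

lemma theta_0 [simp]: "theta T 0 = 0"
  using theta_minus[of 0] by simp

text \<open>The multiplier is the sign (-1)^m, kept as an exponential so that it makes sense for
  negative \<open>m\<close> and merges with other values of \<open>nome\<close>.\<close>

lemma theta_add_int: "theta T (w + of_int m) = nome (- of_int m / 2) * theta T w"
proof -
  have "nome (- (w + of_int m) / 2) = nome (- of_int m / 2) * nome (- w / 2)"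
    unfolding nome_add[symmetric] by (rule arg_cong[of _ _ nome]) (simp add: field_simps)
  moreover have "nome (T - (w + of_int m)) = nome (T - w)"
    using nome_add[of "T - w" "of_int (- m)"] nome_of_int[of "- m"] by (simp add: algebra_simps)
  ultimately show ?thesis
    by (simp add: theta_def nome_add)
qed

lemma theta_add_1: "theta T (w + 1) = - theta T w"
  using theta_add_int[of w 1] nome_minus[of "1/2"] by (simp add: nome_half)

text \<open>The shift removes \<open>1 - nome w\<close> from one product and adds
  \<open>1 - nome (- w)\<close> to the other; these two factors differ only by an
  exponential.\<close>

lemma theta_add_period: "theta T (w + T) = - nome (- w - T / 2) * theta T w"
proof -
  have "nome (- w / 2 - T / 2) * nome (- w) = nome (- w - T / 2) * nome (- w / 2)"
    unfolding nome_add[symmetric] by (rule arg_cong[of _ _ nome]) (simp add: field_simps)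
  moreover have "nome (- w - T / 2) * nome (- w / 2) * nome w = nome (- w / 2 - T / 2)"
    unfolding nome_add[symmetric] by (rule arg_cong[of _ _ nome]) (simp add: field_simps)
  ultimately have 1: "nome (- w / 2 - T / 2) * (1 - nome (- w))
      = - nome (- w - T / 2) * nome (- w / 2) * (1 - nome w)"
    by (simp add: right_diff_distrib)
  have "nome (- (w + T) / 2) = nome (- w / 2 - T / 2)"
    by (rule arg_cong[of _ _ nome]) (simp add: field_simps)
  then have "theta T (w + T) = (nome (- w / 2 - T / 2) * (1 - nome (- w)))
      * qpoch (nome T) (nome (w + T)) * qpoch (nome T) (nome (T - w))"
    unfolding theta_def using qpoch_nome_shift[of "- w"] by (simp del: minus_add_distrib)
  then show ?thesis
    unfolding 1 theta_def by (simp add: qpoch_nome_shift[of w])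
qed

text \<open>The constant is (-1)^n exp(-pi i n^2 T), but later arguments only need that it does not
  depend on \<open>u\<close>, or also that it is nonzero.\<close>

lemma theta_add_period_multiple:
  "\<exists>E. E \<noteq> 0 \<and> (\<forall>u. theta T (u + of_int n * T) = E * nome (- of_int n * u) * theta T u)"
proof (induction n rule: int_induct[of _ 0])
  case base
  show ?case by (intro exI[of _ 1]) simp
next
  case (step1 n)
  then obtain E where E: "E \<noteq> 0" "\<And>u. theta T (u + of_int n * T) = E * nome (- of_int n * u) * theta T u"
    by blast
  have "theta T (u + of_int (n + 1) * T)
      = (- E * nome (- of_int n * T - T / 2)) * nome (- of_int (n + 1) * u) * theta T u" for u
  proof -
    have "theta T (u + of_int (n + 1) * T) = theta T ((u + of_int n * T) + T)"
      by (simp add: algebra_simps)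
    also have "\<dots> = - nome (- (u + of_int n * T) - T / 2) * (E * nome (- of_int n * u) * theta T u)"
      by (simp only: theta_add_period E)
    also have "nome (- (u + of_int n * T) - T / 2) = nome (- of_int n * T - T / 2) * nome (- u)"
      by (simp add: nome_add[symmetric] algebra_simps)
    finally have "theta T (u + of_int (n + 1) * T)
      = - E * nome (- of_int n * T - T / 2) * (nome (- of_int n * u) * nome (- u)) * theta T u"
      by (simp add: mult_ac)
    also have "nome (- of_int n * u) * nome (- u) = nome (- of_int (n + 1) * u)"
      by (simp add: nome_add[symmetric] algebra_simps)
    finally show ?thesis .
  qed
  then show ?case
    using E(1) by (intro exI[of _ "- E * nome (- of_int n * T - T / 2)"]) simp
next
  case (step2 n)
  then obtain E where E: "E \<noteq> 0" "\<And>u. theta T (u + of_int n * T) = E * nome (- of_int n * u) * theta T u"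
    by blast
  have "theta T (u + of_int (n - 1) * T)
      = (- E * nome (of_int n * T - T / 2)) * nome (- of_int (n - 1) * u) * theta T u" for u
  proof -
    have 1: "theta T (u - T) = - nome (u - T / 2) * theta T u"
    proof -
      have "theta T u = - nome (- u + T / 2) * theta T (u - T)"
        using theta_add_period[of "u - T"] by (simp add: algebra_simps)
      moreover have "nome (u - T / 2) * nome (- u + T / 2) = 1"
        by (simp add: nome_add[symmetric])
      ultimately show ?thesis
        by (simp add: mult.assoc[symmetric])
    qed
    have "theta T (u + of_int (n - 1) * T) = theta T ((u - T) + of_int n * T)"
      by (simp add: algebra_simps)
    also have "\<dots> = E * nome (- of_int n * (u - T)) * (- nome (u - T / 2) * theta T u)"
      by (simp only: E 1)
    also have "\<dots> = - E * (nome (- of_int n * (u - T)) * nome (u - T / 2)) * theta T u"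
      by (simp add: mult_ac)
    also have "nome (- of_int n * (u - T)) * nome (u - T / 2)
        = nome (of_int n * T - T / 2) * nome (- of_int (n - 1) * u)"
      by (simp add: nome_add[symmetric] algebra_simps)
    finally show ?thesis
      by (simp add: mult_ac)
  qed
  then show ?case
    using E(1) by (intro exI[of _ "- E * nome (of_int n * T - T / 2)"]) simp
qed

lemma theta_add_lattice:
  "\<exists>E. E \<noteq> 0 \<and> (\<forall>u. theta T (u + of_int m + of_int n * T) = E * nome (- of_int n * u) * theta T u)"
proof -
  obtain E where E: "E \<noteq> 0" "\<And>u. theta T (u + of_int n * T) = E * nome (- of_int n * u) * theta T u"
    using theta_add_period_multiple by blast
  have "theta T (u + of_int m + of_int n * T)
      = (E * nome (- of_int m / 2)) * nome (- of_int n * u) * theta T u" for u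
  proof -
    have "nome (- of_int n * (u + of_int m)) = nome (- of_int n * u)"
      using nome_add[of "- of_int n * u" "of_int (- n * m)"] nome_of_int[of "- n * m"]
      by (simp add: algebra_simps)
    then show ?thesis
      by (simp only: E theta_add_int) (simp only: mult_ac)
  qed
  then show ?thesis
    using E(1) by (intro exI[of _ "E * nome (- of_int m / 2)"]) simp
qed

text \<open>A vanishing product has a vanishing factor: the first product yields the lattice points
  with nonpositive coefficient of \<open>T\<close>, the second those with positive coefficient.
  Conversely, the zero at the origin, due to oddness, is carried to the whole lattice by the
  multipliers.\<close>

lemma theta_eq_0_iff: "theta T w = 0 \<longleftrightarrow> (\<exists>m n. w = of_int m + of_int n * T)"
proof
  assume "theta T w = 0"
  then consider n where "nome T ^ n * nome w = 1" | n where "nome T ^ n * nome (T - w) = 1"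
    unfolding theta_def using qpoch_eq_0_iff[OF norm_nome_less_1[OF T]] by auto
  then show "\<exists>m n. w = of_int m + of_int n * T"
  proof cases
    case (1 n)
    then have "nome (of_nat n * T + w) = 1"
      by (simp add: nome_power nome_add)
    then obtain m where "of_nat n * T + w = of_int m"
      by (auto simp: nome_eq_1_iff)
    then show ?thesis
      by (intro exI[of _ m] exI[of _ "- int n"]) (simp add: algebra_simps)
  next
    case (2 n)
    then have "nome (of_nat n * T + (T - w)) = 1"
      by (subst nome_add) (simp add: nome_power)
    then obtain m where "of_nat n * T + (T - w) = of_int m"
      by (auto simp: nome_eq_1_iff)
    then show ?thesis
      by (intro exI[of _ "- m"] exI[of _ "int n + 1"]) (simp add: algebra_simps)
  qed
next
  assume "\<exists>m n. w = of_int m + of_int n * T"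
  then obtain m n where "w = 0 + of_int m + of_int n * T" by auto
  then show "theta T w = 0"
    using theta_add_lattice[of m n] by (metis mult_zero_right theta_0)
qed

text \<open>The zero at the origin comes from the single factor \<open>1 - nome w\<close>; the
  cofactor there is the square of \<open>qpoch (nome T) (nome T)\<close>, which cannot vanish
  because \<open>nome T\<close> has norm less than 1.\<close>

lemma deriv_theta_0: "deriv (theta T) 0 \<noteq> 0"
proof -
  let ?B = "\<lambda>w. qpoch (nome T) (nome (w + T)) * qpoch (nome T) (nome (T - w))"
  have "?B holomorphic_on UNIV"
    by (intro holomorphic_intros holomorphic_qpoch_nome)
  then have B: "(?B has_field_derivative deriv ?B 0) (at 0)"
    by (auto intro: holomorphic_derivI)
  have "((\<lambda>w. (nome (- w / 2) * (1 - nome w)) * ?B w) has_field_derivative - (2 * of_real pi * \<i>) * ?B 0) (at 0)"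
  proof -
    have "((\<lambda>w. nome (- w / 2)) has_field_derivative 2 * of_real pi * \<i> * (- 1 / 2) * nome (- 0 / 2)) (at 0)"
      by (rule has_field_derivative_nome) (auto intro!: derivative_eq_intros)
    moreover have "(nome has_field_derivative 2 * of_real pi * \<i> * 1 * nome 0) (at 0)"
      by (rule has_field_derivative_nome) (rule DERIV_ident)
    ultimately show ?thesis
      by (rule DERIV_cong[OF DERIV_mult[OF DERIV_mult[OF _ DERIV_diff[OF DERIV_const]] B]]) simp
  qed
  moreover have "theta T = (\<lambda>w. (nome (- w / 2) * (1 - nome w)) * ?B w)"
    unfolding theta_def[abs_def] by (subst qpoch_nome_shift) (simp add: mult_ac)
  ultimately have "deriv (theta T) 0 = - (2 * of_real pi * \<i>) * ?B 0"
    by (simp add: DERIV_imp_deriv)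
  moreover have "qpoch (nome T) (nome T) \<noteq> 0"
  proof
    assume "qpoch (nome T) (nome T) = 0"
    then obtain n where "nome T ^ Suc n = 1"
      using qpoch_eq_0_iff[OF norm_nome_less_1[OF T]] by (auto simp: mult_ac)
    then have "norm (nome T) = 1"
      by (metis nat.distinct(1) power_eq_1_iff)
    then show False
      using norm_nome_less_1[OF T] by simp
  qed
  ultimately show ?thesis by simp
qed

text \<open>Translation by a lattice point multiplies \<open>theta T\<close> by a zero-free
  function, so every zero inherits its simplicity from the zero at the origin.\<close>

lemma deriv_theta_zero:
  assumes "theta T s = 0"
  shows "deriv (theta T) s \<noteq> 0"
proof -
  obtain m n where s: "s = of_int m + of_int n * T"
    using assms theta_eq_0_iff by blast
  obtain E where E: "E \<noteq> 0" "\<And>u. theta T (u + s) = E * nome (- of_int n * u) * theta T u"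
    using theta_add_lattice[of m n] s by (metis add.assoc)
  have th: "(theta T has_field_derivative deriv (theta T) x) (at x)" for x
    using holomorphic_theta by (auto intro: holomorphic_derivI)
  have "((\<lambda>u. theta T (u + s)) has_field_derivative deriv (theta T) (0 + s)) (at 0)"
    using th[of "0 + s"] unfolding DERIV_shift .
  moreover have "((\<lambda>u. E * nome (- of_int n * u) * theta T u) has_field_derivative E * deriv (theta T) 0) (at 0)"
    by (rule DERIV_cong, (rule derivative_intros has_field_derivative_nome th refl)+)
       (simp add: T)
  ultimately have "deriv (theta T) s = E * deriv (theta T) 0"
    using E(2) by (simp add: DERIV_unique)
  then show ?thesis
    using E(1) deriv_theta_0 by simp
qed

text \<open>For \<open>T = 7 * \<tau>\<close> this exchanges the multiples of \<tau> with indices j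
  and 7 - j, which folds the indices 4, 5, 6 onto 3, 2, 1.\<close>

lemma theta_period_minus: "theta T (T - w) = nome (w - T / 2) * theta T w"
  using theta_add_period[of "- w"] by (simp add: theta_minus)

text \<open>The Weierstrass identity, read as an identity between functions of \<open>x\<close>. The
  left side vanishes exactly at y and -y modulo the lattice unless \<open>theta T z\<close> is zero;
  the right side vanishes there too. The assumption on \<open>2 * y\<close> keeps the two zero
  classes apart, hence simple.\<close>

lemma theta_three_term:
  assumes y: "theta T (2 * y) \<noteq> 0"
  shows "theta T (x + y) * theta T (x - y) * (theta T z)\<^sup>2
       = theta T (x + z) * theta T (x - z) * (theta T y)\<^sup>2
         - (theta T x)\<^sup>2 * (theta T (y + z) * theta T (y - z))"
proof -
  define f where "f = (\<lambda>x. theta T (x + z) * theta T (x - z) * (theta T y)\<^sup>2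
         - (theta T x)\<^sup>2 * (theta T (y + z) * theta T (y - z)))"
  define g where "g = (\<lambda>x. theta T (x + y) * theta T (x - y))"
  \<comment> \<open>In \<open>theta T (x + a) * theta T (x - a)\<close> the dependence of the
    multiplier on \<open>a\<close> cancels, so all terms of the identity share this one.\<close>
  define c where "c = (\<lambda>x. nome (- 2 * x - T))"
  have th: "(theta T has_field_derivative deriv (theta T) x) (at x)" for x
    using holomorphic_theta by (auto intro: holomorphic_derivI)
  have th_shift: "((\<lambda>x. theta T (x + a)) has_field_derivative deriv (theta T) (x + a)) (at x)" for a x
    using th[of "x + a"] by (simp add: DERIV_shift)
  have hol: "(\<lambda>w. theta T (h w)) holomorphic_on UNIV" if "h holomorphic_on UNIV" for h
    using holomorphic_on_compose_gen[OF that holomorphic_theta] by (simp add: o_def)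
  have per: "theta T (x + T + a) * theta T (x + T - a) = c x * (theta T (x + a) * theta T (x - a))" for x a
  proof -
    have "nome (- (x + a) - T / 2) * nome (- (x - a) - T / 2) = c x"
      unfolding c_def nome_add[symmetric] by (rule arg_cong[of _ _ nome]) (simp add: field_simps)
    then show ?thesis
      using theta_add_period[of "x + a"] theta_add_period[of "x - a"] by (simp add: add_ac add_diff_eq mult_ac diff_add_eq)
  qed
  have per1: "theta T (x + 1 + a) * theta T (x + 1 - a) = theta T (x + a) * theta T (x - a)" for x a
    using theta_add_1[of "x + a"] theta_add_1[of "x - a"] by (simp add: add_ac add_diff_eq diff_add_eq)
  have f_minus: "f (- x) = f x" for x
    using theta_minus[of "x + z"] theta_minus[of "x - z"] theta_minus[of x]
    by (simp add: f_def add_ac)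
  \<comment> \<open>Here \<open>x\<close> is congruent to \<open>- y\<close>. Both terms of
    \<open>f\<close> pick up the same factor on moving to \<open>- y\<close>, where \<open>f\<close>
    vanishes because it is even and its two terms coincide at \<open>y\<close>.\<close>
  have f_zero: "f x = 0" if "theta T (x + y) = 0" for x
  proof -
    obtain m n where mn: "x + y = of_int m + of_int n * T"
      using \<open>theta T (x + y) = 0\<close> theta_eq_0_iff by blast
    obtain E where E: "\<And>u. theta T (u + (x + y)) = E * nome (- of_int n * u) * theta T u"
      using theta_add_lattice[of m n] mn by (metis add.assoc)
    have pair: "theta T (x + a) * theta T (x - a)
        = E\<^sup>2 * nome (2 * of_int n * y) * (theta T (- y + a) * theta T (- y - a))" for a
    proof -
      have "nome (- of_int n * (- y + a)) * nome (- of_int n * (- y - a)) = nome (2 * of_int n * y)"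
        unfolding nome_add[symmetric] by (rule arg_cong[of _ _ nome]) (simp add: algebra_simps)
      then show ?thesis
        using E[of "- y + a"] E[of "- y - a"]
        by (simp add: algebra_simps power2_eq_square)
    qed
    have "f x = E\<^sup>2 * nome (2 * of_int n * y) * f (- y)"
      using pair[of z] pair[of 0] by (simp add: f_def power2_eq_square algebra_simps)
    also have "f (- y) = 0"
      using f_minus[of y] by (simp add: f_def)
    finally show ?thesis by simp
  qed
  have "\<exists>C. \<forall>x. f x = C * g x"
  proof (rule equal_multipliers_imp_proportional)
    show "f holomorphic_on UNIV" "g holomorphic_on UNIV"
      unfolding f_def g_def by (intro holomorphic_intros hol)+
    show "Im T > 0" by (rule T)
    show "(\<lambda>_. 1) holomorphic_on UNIV" "c holomorphic_on UNIV"
      unfolding c_def by (intro holomorphic_intros)+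
    show "c x \<noteq> 0" for x
      by (simp add: c_def)
    show "f (x + 1) = 1 * f x" "g (x + 1) = 1 * g x" for x
      using per1[of x z] per1[of x 0] per1[of x y] by (simp_all add: f_def g_def power2_eq_square)
    show "f (x + T) = c x * f x" "g (x + T) = c x * g x" for x
      using per[of x z] per[of x 0] per[of x y]
      by (simp_all add: f_def g_def power2_eq_square algebra_simps)
    fix x assume g0: "g x = 0"
    have "(g has_field_derivative deriv (theta T) (x + y) * theta T (x - y)
        + deriv (theta T) (x - y) * theta T (x + y)) (at x)"
      unfolding g_def
      using DERIV_mult[OF th_shift[of y x] th_shift[of "- y" x]] by simp
    then have "deriv g x = deriv (theta T) (x + y) * theta T (x - y)
        + deriv (theta T) (x - y) * theta T (x + y)"
      by (rule DERIV_imp_deriv)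
    \<comment> \<open>If both factors vanished, the difference of their arguments,
      \<open>2 * y\<close>, would be a lattice point.\<close>
    moreover have "\<not> (theta T (x + y) = 0 \<and> theta T (x - y) = 0)"
    proof
      assume "theta T (x + y) = 0 \<and> theta T (x - y) = 0"
      then obtain m n m' n' where "x + y = of_int m + of_int n * T" "x - y = of_int m' + of_int n' * T"
        unfolding theta_eq_0_iff by blast
      then have "(x + y) - (x - y) = of_int (m - m') + of_int (n - n') * T"
        by (simp add: algebra_simps)
      then have "2 * y = of_int (m - m') + of_int (n - n') * T"
        by simp
      then show False
        using y theta_eq_0_iff by blast
    qed
    ultimately have "deriv g x \<noteq> 0"
      using g0 deriv_theta_zero by (auto simp: g_def)
    moreover have "f x = 0"
    proof (cases "theta T (x + y) = 0")
      case False
      then have "theta T (- x + y) = 0"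
        using g0 theta_minus[of "x - y"] by (simp add: g_def)
      then show ?thesis
        using f_zero[of "- x"] f_minus[of x] by simp
    qed (rule f_zero)
    ultimately show "f x = 0 \<and> deriv g x \<noteq> 0" by blast
  qed auto
  then obtain C where C: "\<And>x. f x = C * g x" by blast
  have "theta T y \<noteq> 0"
  proof
    assume "theta T y = 0"
    then obtain m n where "y = of_int m + of_int n * T"
      using theta_eq_0_iff by blast
    then have "2 * y = of_int (2 * m) + of_int (2 * n) * T"
      by (simp add: algebra_simps)
    then show False
      using y theta_eq_0_iff by blast
  qed
  \<comment> \<open>Evaluation at x = 0 kills the second term of \<open>f\<close>; oddness gives the
    same minus sign in \<open>f 0\<close> and \<open>g 0\<close>.\<close>
  then have "C = (theta T z)\<^sup>2"
    using C[of 0] by (simp add: f_def g_def theta_minus power2_eq_square)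
  with C[of x] show ?thesis
    by (simp add: f_def g_def mult_ac)
qed

end

section \<open>The transformation of \<open>h\<close>\<close>

lemma Im_modular:
  assumes "Im T > 0"
  shows "Im ((2 * T - 7) / (T - 3)) > 0"
proof -
  have "T - 3 \<noteq> 0"
    using assms by (auto simp: complex_eq_iff)
  \<comment> \<open>This form reflects that the matrix with rows (2, -7) and (1, -3) has determinant
    1.\<close>
  then have "(2 * T - 7) / (T - 3) = 2 - 1 / (T - 3)"
    by (simp add: field_simps)
  moreover have "0 < (Re (T - 3))\<^sup>2 + (Im (T - 3))\<^sup>2"
    using assms by (simp add: add_nonneg_pos)
  ultimately show ?thesis
    using assms by (simp add: Im_divide)
qed

text \<open>The numbers 1 and \<open>T - 3\<close> form a basis of the lattice of \<open>T\<close>.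
  Division by \<open>T - 3\<close> turns them into \<open>2 - T'\<close> and 1, both in the lattice
  of \<open>T'\<close>, and the Gaussian factor makes the multipliers agree. The constant may stay
  unknown: numerator and denominator of \<open>h_fun\<close> have the same degree in theta
  values.\<close>

lemma theta_modular:
  assumes T: "Im T > 0"
  shows "\<exists>C. \<forall>z. theta ((2 * T - 7) / (T - 3)) (z / (T - 3))
    = C * (nome (z\<^sup>2 / (2 * (T - 3))) * theta T z)"
proof -
  define J where "J = T - 3"
  define T' where "T' = (2 * T - 7) / J"
  have J: "Im J > 0" "J \<noteq> 0"
    using T by (auto simp: J_def complex_eq_iff)
  have T'_eq: "T' = 2 - 1 / J"
    using J by (simp add: T'_def J_def field_simps)
  have T': "Im T' > 0"
    using Im_modular[OF T] by (simp add: T'_def J_def)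
  define f where "f = (\<lambda>z. theta T' (z / J))"
  define e where "e = (\<lambda>z. nome (z\<^sup>2 / (2 * J)))"
  define g where "g = (\<lambda>z. e z * theta T z)"
  define c where "c = (\<lambda>z. - nome (z / J + 1 / (2 * J)))"
  have e: "e holomorphic_on UNIV" and e0: "e z \<noteq> 0" for z
    unfolding e_def using J by (auto intro!: holomorphic_intros)
  have "\<exists>C. \<forall>z. f z = C * g z"
  proof (rule equal_multipliers_imp_proportional)
    have "theta T' \<circ> (\<lambda>z. z / J) holomorphic_on UNIV"
      using J by (intro holomorphic_on_compose_gen[OF _ holomorphic_theta[OF T']] holomorphic_intros) auto
    then show "f holomorphic_on UNIV"
      by (simp add: f_def o_def)
    show "g holomorphic_on UNIV"
      unfolding g_def by (intro holomorphic_intros e holomorphic_theta[OF T])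
    show "Im J > 0" by (rule J)
    show "c holomorphic_on UNIV" "(\<lambda>_. - 1) holomorphic_on UNIV"
      unfolding c_def using J by (auto intro!: holomorphic_intros)
    show "c z \<noteq> 0" for z
      by (simp add: c_def)
    show "f (z + 1) = c z * f z" for z
    proof -
      \<comment> \<open>As \<open>1 / J = 2 - T'\<close>, the shift of \<open>z\<close> by 1 moves
        the argument by 2, which costs no sign, and by \<open>- T'\<close>, which oddness and
        reflection evaluate.\<close>
      have "nome (- of_int 2 / 2) = 1"
        using nome_of_int[of "- 1"] by simp
      then have "theta T' ((z + 1) / J) = theta T' (- (T' - z / J))"
        using theta_add_int[OF T', of "- (T' - z / J)" 2]
        by (simp add: T'_eq add_divide_distrib algebra_simps)
      moreover have "nome (z / J - T' / 2) = - c z"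
      proof -
        have "z / J - T' / 2 = (z / J + 1 / (2 * J)) + of_int (- 1)"
          by (simp add: T'_eq diff_divide_distrib)
        then show ?thesis
          unfolding c_def by (simp only: nome_add nome_of_int) simp
      qed
      ultimately show ?thesis
        unfolding f_def by (simp only: theta_minus[OF T'] theta_period_minus[OF T']) simp
    qed
    show "g (z + 1) = c z * g z" for z
    proof -
      have "e (z + 1) = e z * nome (z / J + 1 / (2 * J))"
        unfolding e_def nome_add[symmetric] using J
        by (intro arg_cong[of _ _ nome]) (simp add: field_simps power2_eq_square)
      then show ?thesis
        by (simp add: g_def c_def theta_add_1[OF T])
    qed
    show "f (z + J) = - 1 * f z" for z
      using J theta_add_1[OF T', of "z / J"] by (simp add: f_def add_divide_distrib)
    show "g (z + J) = - 1 * g z" for z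
    proof -
      have "e (z + J) = e z * nome (z + J / 2)"
        unfolding e_def nome_add[symmetric] using J
        by (intro arg_cong[of _ _ nome]) (simp add: field_simps power2_eq_square)
      \<comment> \<open>The shift by \<open>J\<close> is one by \<open>T\<close> and one by -3; the
        sign of the odd integer shift cancels that of the period shift.\<close>
      moreover have "nome (- of_int (- 3) / 2) = - 1"
        using nome_add[of "1 / 2" 1] by (simp add: nome_half)
      then have "theta T (z + J) = nome (- z - T / 2) * theta T z"
        using theta_add_int[OF T, of "z + T" "- 3"] theta_add_period[OF T, of z]
        by (simp add: J_def add_diff_eq)
      moreover have "nome (z + J / 2) * nome (- z - T / 2) = - 1"
      proof -
        have "nome (z + J / 2) * nome (- z - T / 2) = nome (1 / 2 + of_int (- 2))"
          unfolding nome_add[symmetric]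
          by (rule arg_cong[of _ _ nome]) (simp add: J_def field_simps)
        then show ?thesis
          by (simp only: nome_add nome_of_int nome_half) simp
      qed
      ultimately show ?thesis
        by (simp add: g_def mult_ac)
    qed
    fix z assume "g z = 0"
    then have z: "theta T z = 0"
      by (simp add: g_def e0)
    then obtain m n where "z = of_int m + of_int n * T"
      using theta_eq_0_iff[OF T] by blast
    \<comment> \<open>In the basis \<open>J\<close>, 1 the lattice point can be divided by
      \<open>J\<close> directly, and it lands in the lattice of \<open>T'\<close>.\<close>
    then have "z = of_int n * J + of_int (m + 3 * n)"
      by (simp add: J_def algebra_simps)
    then have "z / J = of_int n + of_int (m + 3 * n) * (1 / J)"
      using J by (simp add: field_simps)
    also have "1 / J = 2 - T'"
      by (simp add: T'_eq)
    finally have "z / J = of_int (n + 2 * (m + 3 * n)) + of_int (- (m + 3 * n)) * T'"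
      by (simp add: algebra_simps)
    then have "f z = 0"
      unfolding f_def using theta_eq_0_iff[OF T'] by blast
    moreover have "(g has_field_derivative e z * deriv (theta T) z + deriv e z * theta T z) (at z)"
      unfolding g_def using e holomorphic_theta[OF T]
      by (intro DERIV_mult' holomorphic_derivI[of _ UNIV]) auto
    then have "deriv g z = e z * deriv (theta T) z"
      using z by (simp add: DERIV_imp_deriv)
    then have "deriv g z \<noteq> 0"
      using deriv_theta_zero[OF T z] e0 by simp
    ultimately show "f z = 0 \<and> deriv g z \<noteq> 0" by blast
  qed auto
  then show ?thesis
    by (simp add: f_def g_def e_def T'_def J_def)
qed

section \<open>Theta values at multiples of \<tau> and the transformation of
  \<open>h_fun\<close>\<close>

lemma theta_torsion_nonzero:
  assumes "Im \<tau> > 0" "0 < j" "j < 7"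
  shows "theta (7 * \<tau>) (of_nat j * \<tau>) \<noteq> 0"
proof
  assume "theta (7 * \<tau>) (of_nat j * \<tau>) = 0"
  then obtain m n where "of_nat j * \<tau> = of_int m + of_int n * (7 * \<tau>)"
    using theta_eq_0_iff[of "7 * \<tau>"] assms by auto
  \<comment> \<open>The imaginary part isolates the coefficient of \<tau> and would make
    \<open>j\<close> a multiple of 7.\<close>
  then have "Im (of_nat j * \<tau>) = Im (of_int m + of_int n * (7 * \<tau>))"
    by (rule arg_cong)
  then have "(real j - 7 * of_int n) * Im \<tau> = 0"
    by (simp add: algebra_simps)
  then have "real_of_int (int j) = of_int (7 * n)"
    using assms by simp
  then have "int j = 7 * n"
    by (simp only: of_int_eq_iff)
  then show False
    using assms by presburger
qed

text \<open>The factors of the product with exponents congruent to j and 7 - j modulo 7 pair up into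
  one theta value. The half-exponentials leave s^(3 + 2*2 - 3) = s^4 = q^(-2), so the prefactor
  q^(-1) of \<open>h_fun\<close> becomes q.\<close>

lemma h_fun_theta:
  assumes \<tau>: "Im \<tau> > 0"
  shows "h_fun \<tau> = nome \<tau> * (theta (7 * \<tau>) (3 * \<tau>) * (theta (7 * \<tau>) (2 * \<tau>))\<^sup>2)
    / theta (7 * \<tau>) \<tau> ^ 3"
proof -
  define q where "q = nome \<tau>"
  define P where "P = (\<lambda>j. qpoch (q ^ 7) (q ^ j))"
  define s where "s = nome (- \<tau> / 2)"
  have q7: "norm (q ^ 7) < 1"
    using norm_nome_less_1[of "7 * \<tau>"] \<tau> by (simp add: q_def nome_power)
  have P: "(\<lambda>k. 1 - q ^ (7 * k + j)) has_prod P j" for j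
    using qpoch_has_prod[OF q7, of "q ^ j"] by (simp add: P_def power_mult[symmetric] power_add)
  have "(\<Prod>k. ((1 - q ^ (7*k+3)) * (1 - q ^ (7*k+4)) * (1 - q ^ (7*k+2))^2 * (1 - q ^ (7*k+5))^2)
                        / ((1 - q ^ (7*k+1))^3 * (1 - q ^ (7*k+6))^3))
      = (P 3 * P 4 * (P 2)\<^sup>2 * (P 5)\<^sup>2) / (P 1 ^ 3 * P 6 ^ 3)"
    by (rule sym, rule has_prod_unique)
       (intro has_prod_divide has_prod_mult has_prod_power P)
  then have h: "h_fun \<tau> = inverse q * ((P 3 * P 4 * (P 2)\<^sup>2 * (P 5)\<^sup>2) / (P 1 ^ 3 * P 6 ^ 3))"
    by (simp add: h_fun_def q_def Let_def)
  have th: "theta (7 * \<tau>) (of_nat j * \<tau>) = s ^ j * P j * P (7 - j)" if "j < 7" for j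
  proof -
    have "7 * \<tau> - of_nat j * \<tau> = of_nat (7 - j) * \<tau>"
      using that by (simp add: of_nat_diff algebra_simps)
    then show ?thesis
      by (simp add: theta_def P_def q_def s_def nome_power)
  qed
  have s0: "s \<noteq> 0" and sq: "inverse q = s\<^sup>2"
    using nome_power[of "- \<tau> / 2" 2] nome_minus[of \<tau>] by (simp_all add: s_def q_def)
  then have q: "q = inverse (s\<^sup>2)"
    by (metis inverse_inverse_eq)
  show ?thesis
    using th[of 1] th[of 2] th[of 3] s0 unfolding h sq q_def[symmetric]
    by (simp add: q power_mult_distrib field_simps power2_eq_square power3_eq_cube)
qed

theorem theorem3:
  fixes \<tau> :: complex
  assumes "Im \<tau> > 0"
  shows "h_fun ((2 * \<tau> - 1) / (7 * \<tau> - 3)) = (h_fun \<tau> - 1) / h_fun \<tau>"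
proof -
  define T where "T = 7 * \<tau>"
  define \<tau>' where "\<tau>' = (2 * \<tau> - 1) / (7 * \<tau> - 3)"
  \<comment> \<open>This is q^(-1/2); with every exponential in \<tau> written as a power of it, the
    final computation is rational algebra in a, b, c and s.\<close>
  define s where "s = nome (- \<tau> / 2)"
  define a b c where "a = theta T \<tau>" and "b = theta T (2 * \<tau>)" and "c = theta T (3 * \<tau>)"
  have T: "Im T > 0"
    using assms by (simp add: T_def)
  have J: "Im (T - 3) > 0" "T - 3 \<noteq> 0"
    using T by (auto simp: complex_eq_iff)
  have nz: "a \<noteq> 0" "b \<noteq> 0" "c \<noteq> 0" "s \<noteq> 0"
    using theta_torsion_nonzero[OF assms, of 1] theta_torsion_nonzero[OF assms, of 2]
      theta_torsion_nonzero[OF assms, of 3]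
    by (auto simp: a_def b_def c_def T_def s_def)
  have th4: "theta T (4 * \<tau>) = s * c"
    using theta_period_minus[OF T, of "3 * \<tau>"] by (simp add: T_def s_def c_def)
  have th5: "theta T (5 * \<tau>) = s ^ 3 * b"
    using theta_period_minus[OF T, of "2 * \<tau>"] by (simp add: T_def s_def b_def nome_power)
  have th6: "theta T (6 * \<tau>) = s ^ 5 * a"
    using theta_period_minus[OF T, of \<tau>] by (simp add: T_def s_def a_def nome_power)
  \<comment> \<open>The three-term identity with x = 3\<tau>, y = 2\<tau>, z = \<tau>: all sums and
    differences are multiples of \<tau> with index between 1 and 5, and these fold onto a, b,
    c.\<close>
  have klein: "s ^ 3 * b * a ^ 3 = s * c * b ^ 3 - a * c ^ 3"
  proof -
    have "theta T (2 * (2 * \<tau>)) \<noteq> 0"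
      using th4 nz by simp
    moreover have "3 * \<tau> + 2 * \<tau> = 5 * \<tau>" "3 * \<tau> - 2 * \<tau> = \<tau>" "3 * \<tau> + \<tau> = 4 * \<tau>"
      "3 * \<tau> - \<tau> = 2 * \<tau>" "2 * \<tau> + \<tau> = 3 * \<tau>" "2 * \<tau> - \<tau> = \<tau>"
      by simp_all
    ultimately have "(s ^ 3 * b) * a * a\<^sup>2 = (s * c) * b * b\<^sup>2 - c\<^sup>2 * (c * a)"
      using theta_three_term[OF T, of "2 * \<tau>" "3 * \<tau>" \<tau>]
      unfolding a_def b_def c_def by (simp only: th4 th5 a_def b_def c_def not_False_eq_True simp_thms)
    then show ?thesis
      by (simp add: power2_eq_square power3_eq_cube mult_ac)
  qed
  have nome_s: "nome (of_nat n * \<tau>) = inverse (s ^ (2 * n))" for n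
    using nome_power[of "- \<tau> / 2" "2 * n"] nome_minus[of "of_nat n * \<tau>"] by (simp add: s_def)
  have h: "h_fun \<tau> = c * b\<^sup>2 / (s\<^sup>2 * a ^ 3)"
  proof -
    have "nome \<tau> = inverse (s\<^sup>2)"
      using nome_s[of 1] by simp
    then show ?thesis
      unfolding h_fun_theta[OF assms] T_def[symmetric] a_def[symmetric] b_def[symmetric] c_def[symmetric]
      by (simp add: field_simps)
  qed
  have T': "7 * \<tau>' = (2 * T - 7) / (T - 3)"
    by (simp add: \<tau>'_def T_def)
  obtain C where C: "\<And>z. theta (7 * \<tau>') (z / (T - 3)) = C * (nome (z\<^sup>2 / (2 * (T - 3))) * theta T z)"
    using theta_modular[OF T] unfolding T' by blast
  have \<tau>': "Im \<tau>' > 0"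
    using Im_modular[OF T] unfolding T'[symmetric] by simp
  \<comment> \<open>The Gaussian factor of the modular transformation at z = 2\<tau> - 1, the point
    that division by \<open>T - 3\<close> sends to \<open>\<tau>'\<close>.\<close>
  define E where "E = nome ((2 * \<tau> - 1) * \<tau>' / 2)"
  \<comment> \<open>The point \<open>j * \<tau>'\<close> comes from z = 2j\<tau> - j. The Gaussian
    is quadratic in z, hence the exponent j^2; the integer shift -j gives the sign, and the index
    doubles.\<close>
  have thj: "theta (7 * \<tau>') (of_nat j * \<tau>') = C * E ^ (j\<^sup>2) * (- 1) ^ j * theta T (of_nat (2 * j) * \<tau>)" for j
  proof -
    define z where "z = of_nat j * (2 * \<tau> - 1)"
    have "of_nat j * \<tau>' = z / (T - 3)"
      by (simp add: z_def \<tau>'_def T_def)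
    moreover have "nome (z\<^sup>2 / (2 * (T - 3))) = E ^ (j\<^sup>2)"
      unfolding E_def nome_power
      by (rule arg_cong[of _ _ nome]) (simp add: z_def \<tau>'_def T_def power2_eq_square field_simps)
    moreover have "theta T z = nome (of_nat j * (1 / 2)) * theta T (of_nat (2 * j) * \<tau>)"
      using theta_add_int[OF T, of "of_nat (2 * j) * \<tau>" "- int j"] by (simp add: z_def algebra_simps)
    then have "theta T z = (- 1) ^ j * theta T (of_nat (2 * j) * \<tau>)"
      unfolding nome_power[symmetric] nome_half .
    ultimately show ?thesis
      by (simp only: C) (simp only: mult_ac)
  qed
  have nz': "C \<noteq> 0" "E \<noteq> 0"
    using theta_torsion_nonzero[OF \<tau>', of 1] thj[of 1] by (auto simp: E_def)
  \<comment> \<open>The exponent is 9 + 2*4 - 3 = 14, the total power of \<open>E\<close> in the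
    theta quotient. Together with \<open>nome \<tau>'\<close> the denominator
    \<open>7 * \<tau> - 3\<close> cancels and only an exponential in \<tau> remains.\<close>
  have E14: "nome \<tau>' * E ^ 14 = inverse (s ^ 8)"
  proof -
    have "\<tau>' + of_nat 14 * ((2 * \<tau> - 1) * \<tau>' / 2) = 2 * ((7 * \<tau> - 3) * \<tau>')"
      by (simp add: field_simps)
    also have "(7 * \<tau> - 3) * \<tau>' = 2 * \<tau> - 1"
      using J by (simp add: \<tau>'_def T_def)
    finally have "nome \<tau>' * E ^ 14 = nome (of_nat 4 * \<tau> + of_int (- 2))"
      unfolding E_def nome_power nome_add[symmetric] by simp
    then show ?thesis
      by (simp only: nome_add nome_of_int nome_s) simp
  qed
  have E17: "nome \<tau>' * (E ^ 9 * (E ^ 4)\<^sup>2) = inverse (s ^ 8) * E ^ 3"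
    unfolding E14[symmetric] by (simp add: mult.assoc power_add[symmetric] power_mult[symmetric])
  \<comment> \<open>The indices 1, 2, 3 become 2, 4, 6; the last two fold back onto \<open>c\<close>
    and \<open>a\<close>.\<close>
  have th': "theta (7 * \<tau>') \<tau>' = - (C * E * b)"
    "theta (7 * \<tau>') (2 * \<tau>') = C * E ^ 4 * (s * c)"
    "theta (7 * \<tau>') (3 * \<tau>') = - (C * E ^ 9 * (s ^ 5 * a))"
    using thj[of 1] thj[of 2] thj[of 3] by (simp_all add: th4 th6 b_def)
  have "h_fun \<tau>' = nome \<tau>' * (theta (7 * \<tau>') (3 * \<tau>') * (theta (7 * \<tau>') (2 * \<tau>'))\<^sup>2)
      / theta (7 * \<tau>') \<tau>' ^ 3"
    by (rule h_fun_theta[OF \<tau>'])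
  also have "\<dots> = (nome \<tau>' * (E ^ 9 * (E ^ 4)\<^sup>2)) * (s ^ 5 * a * (s * c)\<^sup>2) / (E ^ 3 * b ^ 3)"
    unfolding th' using nz' nz by (simp add: field_simps power2_eq_square power3_eq_cube)
  also have "\<dots> = a * c\<^sup>2 / (s * b ^ 3)"
    unfolding E17 using nz nz' by (simp add: field_simps power_mult_distrib power_add[symmetric] flip: power_Suc)
  also have "\<dots> = (h_fun \<tau> - 1) / h_fun \<tau>"
  proof -
    have "(h_fun \<tau> - 1) / h_fun \<tau> = (c * b\<^sup>2 - s\<^sup>2 * a ^ 3) / (c * b\<^sup>2)"
      using nz by (simp add: h field_simps)
    \<comment> \<open>Expanding the fraction by \<open>s * b\<close> produces exactly the term that
      the quartic relation replaces.\<close>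
    also have "\<dots> = (s * c * b ^ 3 - s ^ 3 * b * a ^ 3) / (s * c * b ^ 3)"
      using nz by (simp add: field_simps power2_eq_square power3_eq_cube)
    also have "\<dots> = a * c\<^sup>2 / (s * b ^ 3)"
      unfolding klein using nz by (simp add: field_simps power2_eq_square power3_eq_cube)
    finally show ?thesis by simp
  qed
  finally show ?thesis
    by (simp add: \<tau>'_def)
qed

end
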